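(* For every $n\ge 2$, $MC(B_n)=\binom{n}{2}+1$.
   Context: Let $\Delta$ be a finite irreducible crystallographic root system with a fixed positive system $\Delta^+$ and Weyl group $W$. For $w\in W$ set $N(w)=\{\alpha\in\Delta^+\mid w^{-1}(\alpha)\in-\Delta^+\}$. A subset $Y\subset W$ is inversion complete if $\bigcup_{w\in Y}N(w)=\Delta^+$; it is minimal inversion complete if it is inversion complete and no proper subset of $Y$ is inversion complete. If $\Delta$ is of type $T$, $MC(T)$ denotes the maximal cardinality of a minimal inversion complete subset of $W$. The root system of type $B_n$ is $\Delta=\{\pm(\epsilon_i\pm\epsilon_j)\mid 1\le i<j\le n\}\cup\{\pm\epsilon_i\mid 1\le i\le n\}\subset\mathbb{R}^n$, where $\{\epsilon_i\}$ is the standard basis, with $\Delta^+=\{\epsilon_i\pm\epsilon_j\mid 1\le i<j\le n\}\cup\{\epsilon_i\mid 1\le i\le n\}$. *)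

theory Defs
  imports
    "HOL-Analysis.Analysis"
    "HOL-Algebra.Generated_Groups"
    "HOL-Algebra.Bij"
begin

text \<open>
  In the following, \<open>\<Delta>\<close> is a root system in a real inner product space and \<open>P\<close> is a
  positive system of \<open>\<Delta>\<close>; both are passed as explicit arguments.
\<close>

definition reflection :: "'a::real_inner \<Rightarrow> 'a \<Rightarrow> 'a" where
  "reflection \<alpha> x = x - (2 * (x \<bullet> \<alpha>) / (\<alpha> \<bullet> \<alpha>)) *\<^sub>R \<alpha>"

definition weyl_group :: "'a::real_inner set \<Rightarrow> ('a \<Rightarrow> 'a) set" where
  "weyl_group \<Delta> = generate (BijGroup UNIV) (reflection ` \<Delta>)"

text \<open>\<open>inv_into UNIV w\<close> is the inverse function of \<open>w\<close>; the notation \<open>inv w\<close> would be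
  ambiguous with the inverse in a group.\<close>

definition inversion_set :: "'a::real_inner set \<Rightarrow> ('a \<Rightarrow> 'a) \<Rightarrow> 'a set" where
  "inversion_set P w = {\<alpha> \<in> P. inv_into UNIV w \<alpha> \<in> uminus ` P}"

definition inversion_complete ::
    "'a::real_inner set \<Rightarrow> 'a set \<Rightarrow> ('a \<Rightarrow> 'a) set \<Rightarrow> bool" where
  "inversion_complete \<Delta> P Y \<longleftrightarrow>
     Y \<subseteq> weyl_group \<Delta> \<and> (\<Union>w\<in>Y. inversion_set P w) = P"

definition minimal_inversion_complete ::
    "'a::real_inner set \<Rightarrow> 'a set \<Rightarrow> ('a \<Rightarrow> 'a) set \<Rightarrow> bool" where
  "minimal_inversion_complete \<Delta> P Y \<longleftrightarrow>
     inversion_complete \<Delta> P Y \<and> (\<forall>Z. Z \<subset> Y \<longrightarrow> \<not> inversion_complete \<Delta> P Z)"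

text \<open>The Weyl group of a finite root system is finite and is itself inversion complete, so \<open>Max\<close>
  is taken over a finite nonempty set.\<close>

definition MC :: "'a::real_inner set \<Rightarrow> 'a set \<Rightarrow> nat" where
  "MC \<Delta> P = Max (card ` {Y. minimal_inversion_complete \<Delta> P Y})"

text \<open>The root system of type \<open>B\<close> and rank \<open>n = CARD('n)\<close>: the coordinates are indexed by the
  finite linearly ordered type \<open>'n\<close> in place of \<open>{1..n}\<close>, and \<open>axis i 1\<close> is the standard basis
  vector \<open>\<epsilon>\<^sub>i\<close>.\<close>

definition B_pos_roots :: "(real ^ 'n::{finite, linorder}) set" where
  "B_pos_roots =
     {axis i 1 + axis j 1 | i j. i < j} \<union> {axis i 1 - axis j 1 | i j. i < j} \<union>
     {axis i 1 | i. True}"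

definition B_roots :: "(real ^ 'n::{finite, linorder}) set" where
  "B_roots =
     {axis i 1 + axis j 1 | i j. i < j} \<union> {- (axis i 1 + axis j 1) | i j. i < j} \<union>
     {axis i 1 - axis j 1 | i j. i < j} \<union> {- (axis i 1 - axis j 1) | i j. i < j} \<union>
     {axis i 1 | i. True} \<union> {- axis i 1 | i. True}"

end

theory Submission
  imports Defs
begin

text \<open>
  Fix a vector \<open>\<rho>\<close> that is positive on the positive roots. Membership of a positive root \<open>\<beta>\<close> in
  \<open>N(w)\<close> then means \<open>w \<rho> \<bullet> \<beta> < 0\<close>. In a minimal inversion complete set every \<open>w\<close> owns a root that no
  other element inverts; let \<open>S\<close> be the set of these roots. If \<open>\<epsilon>\<^sub>i + \<epsilon>\<^sub>j\<close> and \<open>\<epsilon>\<^sub>i - \<epsilon>\<^sub>j\<close> both lie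
  in \<open>S\<close> for some \<open>i < j\<close>, then \<open>\<epsilon>\<^sub>i\<close> is not in \<open>S\<close>, and \<open>j\<close> is determined by \<open>i\<close>, since \<open>\<epsilon>\<^sub>i\<close> must
  be inverted by some \<open>w\<close> and cannot have two representations in the cone over \<open>S\<close> with
  disjoint supports. Let \<open>T\<close> be the set of \<open>i\<close> for which \<open>\<epsilon>\<^sub>i\<close> is in \<open>S\<close> or which occur as such a
  smaller index. Then \<open>card S\<close> is \<open>n choose 2\<close> plus \<open>card T\<close> minus the number of pairs \<open>i < j\<close>
  with neither \<open>\<epsilon>\<^sub>i + \<epsilon>\<^sub>j\<close> nor \<open>\<epsilon>\<^sub>i - \<epsilon>\<^sub>j\<close> in \<open>S\<close>, and each element of \<open>T\<close> except the
  largest is the smaller index of such an empty pair.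

  The bound is attained with \<open>S\<close> consisting of all \<open>\<epsilon>\<^sub>i + \<epsilon>\<^sub>j\<close> and the last \<open>\<epsilon>\<^sub>n\<close>.
\<close>

section \<open>Inversion sets and chambers\<close>

lemma reflection_reflection:
  assumes "\<alpha> \<noteq> 0"
  shows "reflection \<alpha> (reflection \<alpha> x) = x"
  using assms by (simp add: reflection_def inner_diff_left algebra_simps)

lemma orthogonal_transformation_reflection: "orthogonal_transformation (reflection \<alpha>)"
proof (cases "\<alpha> = 0")
  case True
  then show ?thesis
    by (simp add: orthogonal_transformation_def reflection_def linear_iff)
next
  case False
  then show ?thesis
    unfolding orthogonal_transformation_def linear_iff reflection_def
    by (auto simp: inner_simps algebra_simps add_divide_distrib inner_commute)
qed

text \<open>Positivity of \<open>\<rho>\<close> on \<open>P\<close> stands in for a choice of simple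
  roots: it keeps \<open>P\<close> apart from its negatives and excludes the root 0.\<close>

locale positive_system =
  fixes \<Delta> P :: "'a::real_inner set" and \<rho> :: 'a
  assumes finite_roots: "finite \<Delta>"
    and span_roots: "span \<Delta> = UNIV"
    and roots_eq: "\<Delta> = P \<union> uminus ` P"
    and rho_pos: "\<beta> \<in> P \<Longrightarrow> \<rho> \<bullet> \<beta> > 0"
    and reflection_mem: "\<alpha> \<in> \<Delta> \<Longrightarrow> \<beta> \<in> \<Delta> \<Longrightarrow> reflection \<alpha> \<beta> \<in> \<Delta>"
begin

section \<open>The Weyl group as a finite group of root-preserving isometries\<close>

lemma root_nonzero: "\<alpha> \<in> \<Delta> \<Longrightarrow> \<alpha> \<noteq> 0"
  using rho_pos by (force simp: roots_eq)

lemma reflection_Bij: "\<alpha> \<in> \<Delta> \<Longrightarrow> reflection \<alpha> \<in> Bij UNIV"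
  unfolding Bij_def
  by (auto intro!: o_bij[where g = "reflection \<alpha>"] simp: fun_eq_iff reflection_reflection root_nonzero)

lemma inv_reflection: "\<alpha> \<in> \<Delta> \<Longrightarrow> inv_into UNIV (reflection \<alpha>) = reflection \<alpha>"
  by (rule inv_equality) (auto simp: reflection_reflection root_nonzero)

lemma weyl_group_elem:
  assumes "w \<in> weyl_group \<Delta>"
  shows "orthogonal_transformation w \<and> bij w \<and> w ` \<Delta> \<subseteq> \<Delta>"
  using assms unfolding weyl_group_def
proof (induction rule: generate.induct)
  case one
  then show ?case
    by (simp add: BijGroup_def orthogonal_transformation_id[unfolded id_def] bij_id[unfolded id_def])
next
  case (incl h)
  then show ?case
    using reflection_Bij reflection_mem
    by (auto simp: Bij_def orthogonal_transformation_reflection)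
next
  case (inv h)
  then obtain \<alpha> where \<alpha>: "\<alpha> \<in> \<Delta>" "h = reflection \<alpha>" by auto
  then have "inv\<^bsub>BijGroup UNIV\<^esub> h = reflection \<alpha>"
    by (simp add: inv_BijGroup reflection_Bij inv_reflection restrict_UNIV)
  with \<alpha> show ?case
    using reflection_Bij reflection_mem
    by (auto simp: Bij_def orthogonal_transformation_reflection)
next
  case (eng h1 h2)
  then have "h1 \<otimes>\<^bsub>BijGroup UNIV\<^esub> h2 = h1 \<circ> h2"
    by (simp add: BijGroup_def Bij_def compose_def comp_def restrict_UNIV)
  with eng.IH show ?case
    by (auto simp: image_comp[symmetric] simp del: comp_apply
        intro: orthogonal_transformation_compose bij_comp)
qed

lemma reflection_in_weyl: "\<alpha> \<in> \<Delta> \<Longrightarrow> reflection \<alpha> \<in> weyl_group \<Delta>"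
  unfolding weyl_group_def by (auto intro: generate.incl)

lemma id_in_weyl: "(\<lambda>x. x) \<in> weyl_group \<Delta>"
  using generate.one[of "BijGroup UNIV"] unfolding weyl_group_def by (simp add: BijGroup_def restrict_UNIV)

lemma comp_in_weyl:
  assumes "v \<in> weyl_group \<Delta>" "w \<in> weyl_group \<Delta>"
  shows "v \<circ> w \<in> weyl_group \<Delta>"
proof -
  have "v \<otimes>\<^bsub>BijGroup UNIV\<^esub> w = v \<circ> w"
    using assms weyl_group_elem by (simp add: BijGroup_def Bij_def compose_def comp_def restrict_UNIV)
  then show ?thesis
    using generate.eng assms unfolding weyl_group_def by metis
qed

text \<open>A linear map is determined by its values on the spanning set \<open>\<Delta>\<close>,
  and there are only finitely many maps from \<open>\<Delta>\<close> to itself.\<close>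

lemma finite_weyl_group: "finite (weyl_group \<Delta>)"
proof (rule inj_on_finite)
  show "inj_on (\<lambda>w. restrict w \<Delta>) (weyl_group \<Delta>)"
  proof (rule inj_onI)
    fix v w assume vw: "v \<in> weyl_group \<Delta>" "w \<in> weyl_group \<Delta>" "restrict v \<Delta> = restrict w \<Delta>"
    have "linear v" "linear w"
      using vw weyl_group_elem orthogonal_transformation_linear by blast+
    moreover have "v y = w y" if "y \<in> \<Delta>" for y
      using that vw(3) by (metis restrict_apply')
    ultimately have "v x = w x" for x
      using linear_eq_on_span[of v w \<Delta> x] span_roots by simp
    then show "v = w" by blast
  qed
  show "(\<lambda>w. restrict w \<Delta>) ` weyl_group \<Delta> \<subseteq> \<Delta> \<rightarrow>\<^sub>E \<Delta>"
    using weyl_group_elem by (fastforce simp: PiE_iff)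
  show "finite (\<Delta> \<rightarrow>\<^sub>E \<Delta>)"
    by (simp add: finite_PiE finite_roots)
qed

lemma inv_weyl_root:
  assumes "w \<in> weyl_group \<Delta>" "\<beta> \<in> \<Delta>"
  shows "inv_into UNIV w \<beta> \<in> \<Delta>"
proof -
  have "inj w" "w ` \<Delta> \<subseteq> \<Delta>"
    using weyl_group_elem[OF assms(1)] by (auto simp: bij_is_inj)
  then have "w ` \<Delta> = \<Delta>"
    by (metis card_image card_subset_eq finite_roots inj_on_subset subset_UNIV)
  with assms(2) \<open>inj w\<close> show ?thesis
    by (metis imageE inv_f_f)
qed

section \<open>Inversion sets as sign patterns\<close>

lemma weyl_inner_inv:
  assumes "w \<in> weyl_group \<Delta>"
  shows "w \<rho> \<bullet> \<beta> = \<rho> \<bullet> inv_into UNIV w \<beta>"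
proof -
  have "w (inv_into UNIV w \<beta>) = \<beta>"
    using weyl_group_elem[OF assms] by (simp add: bij_is_surj surj_f_inv_f)
  then show ?thesis
    using weyl_group_elem[OF assms] unfolding orthogonal_transformation_def by metis
qed

text \<open>As \<open>w\<close> is orthogonal, \<open>w \<rho> \<bullet> \<beta>\<close> is the
  value of \<open>\<rho>\<close> on the preimage of \<open>\<beta>\<close>. That preimage is a root,
  so the value is never 0 and both criteria are strict.\<close>

lemma inversion_set_iff:
  assumes "w \<in> weyl_group \<Delta>" "\<beta> \<in> P"
  shows "\<beta> \<in> inversion_set P w \<longleftrightarrow> w \<rho> \<bullet> \<beta> < 0"
    and "\<beta> \<notin> inversion_set P w \<longleftrightarrow> w \<rho> \<bullet> \<beta> > 0"
proof -
  let ?g = "inv_into UNIV w \<beta>"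
  have "?g \<in> P \<or> ?g \<in> uminus ` P"
    using inv_weyl_root[OF assms(1), of \<beta>] assms(2) roots_eq by blast
  moreover have "?g \<in> P \<Longrightarrow> \<rho> \<bullet> ?g > 0" using rho_pos by blast
  moreover have "?g \<in> uminus ` P \<Longrightarrow> \<rho> \<bullet> ?g < 0" using rho_pos by force
  ultimately show "\<beta> \<in> inversion_set P w \<longleftrightarrow> w \<rho> \<bullet> \<beta> < 0"
    and "\<beta> \<notin> inversion_set P w \<longleftrightarrow> w \<rho> \<bullet> \<beta> > 0"
    unfolding inversion_set_def weyl_inner_inv[OF assms(1)] using assms(2) by auto
qed

text \<open>The chamber of \<open>x\<close> is reached by maximising \<open>w \<rho> \<bullet> x\<close> over the Weyl group: replacing \<open>w\<close> by
  \<open>w \<circ> reflection \<gamma>\<close> cannot increase this value.\<close>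

lemma exists_inversion_set:
  assumes "\<And>\<beta>. \<beta> \<in> P \<Longrightarrow> x \<bullet> \<beta> \<noteq> 0"
  obtains w where "w \<in> weyl_group \<Delta>" "inversion_set P w = {\<beta> \<in> P. x \<bullet> \<beta> < 0}"
proof -
  let ?M = "(\<lambda>w. w \<rho> \<bullet> x) ` weyl_group \<Delta>"
  have "finite ?M" "?M \<noteq> {}" using finite_weyl_group id_in_weyl by auto
  then have "Max ?M \<in> ?M" and ub: "\<And>y. y \<in> ?M \<Longrightarrow> y \<le> Max ?M" by auto
  then obtain w where w: "w \<in> weyl_group \<Delta>" "w \<rho> \<bullet> x = Max ?M" by force
  have lin: "linear w" and surj: "surj w"
    using weyl_group_elem[OF w(1)] orthogonal_transformation_linear bij_is_surj by blast+
  have nonneg: "w \<gamma> \<bullet> x \<ge> 0" if "\<gamma> \<in> P" for \<gamma>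
  proof -
    have "\<gamma> \<in> \<Delta>" using that roots_eq by blast
    then have "(w \<circ> reflection \<gamma>) \<rho> \<bullet> x \<le> w \<rho> \<bullet> x"
      unfolding w(2) using comp_in_weyl reflection_in_weyl w(1) by (blast intro: ub)
    moreover have "(w \<circ> reflection \<gamma>) \<rho> = w \<rho> - (2 * (\<rho> \<bullet> \<gamma>) / (\<gamma> \<bullet> \<gamma>)) *\<^sub>R w \<gamma>"
      by (simp add: reflection_def linear_diff[OF lin] linear_cmul[OF lin])
    ultimately have "(2 * (\<rho> \<bullet> \<gamma>) / (\<gamma> \<bullet> \<gamma>)) * (w \<gamma> \<bullet> x) \<ge> 0"
      by (simp add: inner_diff_left)
    moreover have "2 * (\<rho> \<bullet> \<gamma>) / (\<gamma> \<bullet> \<gamma>) > 0"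
      using rho_pos[OF that] root_nonzero[OF \<open>\<gamma> \<in> \<Delta>\<close>] by simp
    ultimately show ?thesis by (metis zero_le_mult_iff not_less)
  qed
  have "\<beta> \<in> inversion_set P w \<longleftrightarrow> x \<bullet> \<beta> < 0" if \<beta>: "\<beta> \<in> P" for \<beta>
  proof -
    define \<gamma> where "\<gamma> = inv_into UNIV w \<beta>"
    have w\<gamma>: "w \<gamma> = \<beta>" unfolding \<gamma>_def using surj by (simp add: surj_f_inv_f)
    have "\<gamma> \<in> P \<or> \<gamma> \<in> uminus ` P"
      unfolding \<gamma>_def using inv_weyl_root[OF w(1), of \<beta>] \<beta> roots_eq by blast
    moreover have "\<not> x \<bullet> \<beta> < 0" if "\<gamma> \<in> P"
      using nonneg[OF that] w\<gamma> by (simp add: inner_commute)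
    moreover have "x \<bullet> \<beta> < 0" if "\<gamma> \<in> uminus ` P"
    proof -
      have "- \<gamma> \<in> P" using that by auto
      \<comment> \<open>Maximality gives only a weak inequality; it is strict because
        \<open>x\<close> lies on no root hyperplane.\<close>
      from nonneg[OF this] have "x \<bullet> \<beta> \<le> 0"
        using w\<gamma> by (simp add: inner_commute linear_neg[OF lin])
      with assms[OF \<beta>] show ?thesis by simp
    qed
    moreover have "\<gamma> \<notin> uminus ` P" if "\<gamma> \<in> P"
    proof
      assume "\<gamma> \<in> uminus ` P"
      then have "- \<gamma> \<in> P" by auto
      from rho_pos[OF this] rho_pos[OF that] show False by simp
    qed
    ultimately show ?thesis
      using \<beta> by (auto simp: inversion_set_def \<gamma>_def)
  qed
  then have "inversion_set P w = {\<beta> \<in> P. x \<bullet> \<beta> < 0}"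
    by (auto simp: inversion_set_def)
  with w(1) that show thesis by blast
qed

text \<open>Without \<open>w\<close> some root is left uncovered. It is private to \<open>w\<close>
  and represents \<open>w\<close> in the later count.\<close>

lemma minimal_inversion_complete_private_root:
  assumes Y: "minimal_inversion_complete \<Delta> P Y" and "w \<in> Y"
  shows "\<exists>\<alpha>\<in>P. \<forall>v\<in>Y. \<alpha> \<in> inversion_set P v \<longleftrightarrow> v = w"
proof -
  have "\<not> inversion_complete \<Delta> P (Y - {w})" "inversion_complete \<Delta> P Y"
    using assms unfolding minimal_inversion_complete_def by blast+
  then have "(\<Union>v\<in>Y - {w}. inversion_set P v) \<noteq> P" "(\<Union>v\<in>Y. inversion_set P v) = P"
    unfolding inversion_complete_def by blast+
  then show ?thesis by blast
qed

lemma finite_minimal_inversion_complete: "finite {Y. minimal_inversion_complete \<Delta> P Y}"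
proof (rule finite_subset)
  show "{Y. minimal_inversion_complete \<Delta> P Y} \<subseteq> Pow (weyl_group \<Delta>)"
    unfolding minimal_inversion_complete_def inversion_complete_def by auto
qed (simp add: finite_weyl_group)

end

section \<open>The combinatorial bound\<close>

text \<open>Formal names for the roots let constructors decide distinctness, so that the counting
  never compares vectors.\<close>

datatype 'n root_index = Plus_Root 'n 'n | Minus_Root 'n 'n | Short_Root 'n

primrec root_vec :: "'n::finite root_index \<Rightarrow> (real, 'n) vec" where
  "root_vec (Plus_Root i j) = axis i 1 + axis j 1"
| "root_vec (Minus_Root i j) = axis i 1 - axis j 1"
| "root_vec (Short_Root i) = axis i 1"

definition pos_indices :: "'n::{finite, linorder} root_index set" where
  "pos_indices = {Plus_Root i j | i j. i < j} \<union> {Minus_Root i j | i j. i < j} \<union> range Short_Root"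

lemma pos_indices_simps [simp]:
  "Plus_Root i j \<in> pos_indices \<longleftrightarrow> i < j"
  "Minus_Root i j \<in> pos_indices \<longleftrightarrow> i < j"
  "Short_Root i \<in> pos_indices"
  by (auto simp: pos_indices_def)

lemma B_pos_roots_eq: "(B_pos_roots :: (real ^ 'n::{finite, linorder}) set) = root_vec ` pos_indices"
proof (rule Set.set_eqI)
  fix v :: "(real, 'n) vec"
  have "v \<in> root_vec ` pos_indices \<longleftrightarrow>
      (\<exists>i j. v = root_vec (Plus_Root i j) \<and> i < j) \<or> (\<exists>i j. v = root_vec (Minus_Root i j) \<and> i < j) \<or>
      (\<exists>i. v = root_vec (Short_Root i))"
    unfolding pos_indices_def by blast
  then show "v \<in> B_pos_roots \<longleftrightarrow> v \<in> root_vec ` pos_indices"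
    by (simp add: B_pos_roots_def)
qed

lemma inner_root_vec [simp]:
  "x \<bullet> root_vec (Plus_Root i j) = x $ i + x $ j"
  "x \<bullet> root_vec (Minus_Root i j) = x $ i - x $ j"
  "x \<bullet> root_vec (Short_Root i) = x $ i"
  by (simp_all add: inner_simps inner_axis)

declare root_vec.simps [simp del]

lemma card_less_pairs: "card {(i, j). (i::'n::{finite, linorder}) < j} = CARD('n) choose 2"
proof -
  have "bij_betw (\<lambda>(i, j). {i, j}) {(i, j). (i::'n) < j} {B. B \<subseteq> UNIV \<and> card B = 2}"
  proof (rule bij_betwI')
    fix B :: "'n set" assume "B \<in> {B. B \<subseteq> UNIV \<and> card B = 2}"
    then obtain a b where "B = {a, b}" "a \<noteq> b" by (auto simp: card_2_iff)
    then show "\<exists>p\<in>{(i, j). i < j}. B = (case p of (i, j) \<Rightarrow> {i, j})"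
      by (cases "a < b") (force simp: insert_commute)+
  qed (auto simp: doubleton_eq_iff)
  then show ?thesis
    using n_subsets[of "UNIV :: 'n set" 2] by (simp add: bij_betw_same_card)
qed

text \<open>Here \<open>x \<alpha>\<close> plays the role of \<open>w \<rho>\<close> for the element
  \<open>w\<close> that owns \<open>\<alpha>\<close>. Only signs enter, so the count is separated
  from the Weyl group.\<close>

lemma card_separated_cover_le:
  fixes S :: "'n::{finite, linorder} root_index set" and x :: "'n root_index \<Rightarrow> real ^ 'n::{finite, linorder}"
  assumes S: "S \<subseteq> pos_indices"
    and neg: "\<And>\<alpha>. \<alpha> \<in> S \<Longrightarrow> x \<alpha> \<bullet> root_vec \<alpha> < 0"
    and pos: "\<And>\<alpha> \<beta>. \<alpha> \<in> S \<Longrightarrow> \<beta> \<in> S \<Longrightarrow> \<alpha> \<noteq> \<beta> \<Longrightarrow> x \<alpha> \<bullet> root_vec \<beta> > 0"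
    and cover: "\<And>\<beta>. \<beta> \<in> pos_indices \<Longrightarrow> \<exists>\<alpha>\<in>S. x \<alpha> \<bullet> root_vec \<beta> < 0"
  shows "card S \<le> (CARD('n) choose 2) + 1"
proof -
  \<comment> \<open>Pairs in \<open>D\<close> contribute two long roots and pairs in
    \<open>Z\<close> none, so \<open>card S\<close> exceeds the number of pairs by
    \<open>card D + card H - card Z\<close>.\<close>
  define A where "A = {(i, j). Plus_Root i j \<in> S}"
  define B where "B = {(i, j). Minus_Root i j \<in> S}"
  define H where "H = {i. Short_Root i \<in> S}"
  define D where "D = A \<inter> B"
  define Q where "Q = {(i, j). (i::'n) < j}"
  define Z where "Z = Q - (A \<union> B)"
  define T where "T = H \<union> fst ` D"
  have AB: "A \<subseteq> Q" "B \<subseteq> Q"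
    using S by (auto simp: A_def B_def Q_def)
  have posA: "x \<alpha> $ i + x \<alpha> $ j > 0" if "\<alpha> \<in> S" "(i, j) \<in> A" "\<alpha> \<noteq> Plus_Root i j" for \<alpha> i j
    using pos[of \<alpha> "Plus_Root i j"] that by (simp add: A_def)
  have posB: "x \<alpha> $ i - x \<alpha> $ j > 0" if "\<alpha> \<in> S" "(i, j) \<in> B" "\<alpha> \<noteq> Minus_Root i j" for \<alpha> i j
    using pos[of \<alpha> "Minus_Root i j"] that by (simp add: B_def)
  have posH: "x \<alpha> $ i > 0" if "\<alpha> \<in> S" "i \<in> H" "\<alpha> \<noteq> Short_Root i" for \<alpha> i
    using pos[of \<alpha> "Short_Root i"] that by (simp add: H_def)
  \<comment> \<open>The two roots of a pair in \<open>D\<close> add up to twice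
    \<open>axis i 1\<close>.\<close>
  have posD: "x \<alpha> $ i > 0" if "\<alpha> \<in> S" "(i, j) \<in> D" "\<alpha> \<notin> {Plus_Root i j, Minus_Root i j}" for \<alpha> i j
    using posA[of \<alpha> i j] posB[of \<alpha> i j] that by (auto simp: D_def)
  have coverH: "\<exists>\<alpha>\<in>S. x \<alpha> $ i < 0" for i
    using cover[of "Short_Root i"] by simp
  have HD: "i \<notin> H" if "(i, j) \<in> D" for i j
  proof
    assume "i \<in> H"
    then have "Short_Root i \<in> S" by (simp add: H_def)
    with posD[OF this that] neg[OF this] show False by simp
  qed
  have Dfun: "j = k" if "(i, j) \<in> D" "(i, k) \<in> D" for i j k
  proof (rule ccontr)
    assume "j \<noteq> k"
    \<comment> \<open>The owner of a vector that is not positive at \<open>i\<close> is a root of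
      every pair in \<open>D\<close> starting at \<open>i\<close>, but distinct pairs share no
      root.\<close>
    obtain \<alpha> where \<alpha>: "\<alpha> \<in> S" "\<not> x \<alpha> $ i > 0" using coverH[of i] by force
    then have "\<alpha> \<in> {Plus_Root i j, Minus_Root i j}" "\<alpha> \<in> {Plus_Root i k, Minus_Root i k}"
      using posD[OF \<alpha>(1) that(1)] posD[OF \<alpha>(1) that(2)] by argo+
    with \<open>j \<noteq> k\<close> show False by auto
  qed
  \<comment> \<open>For \<open>i \<in> T\<close>, \<open>axis i 1\<close> lies in the cone over
    \<open>S\<close>, generated by itself or by the two roots of a pair in \<open>D\<close>. Only
    vectors owned by such generators can fail to be positive at \<open>i\<close>.\<close>
  have posT: "x \<alpha> $ i > 0" if "\<alpha> \<in> S" "i \<in> T" "\<alpha> \<noteq> Short_Root i"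
      "\<And>j. (i, j) \<in> D \<Longrightarrow> \<alpha> \<noteq> Plus_Root i j \<and> \<alpha> \<noteq> Minus_Root i j" for \<alpha> i
  proof (cases "i \<in> H")
    case True
    then show ?thesis using posH[OF that(1)] that(3) by blast
  next
    case False
    with that(2) obtain j where "(i, j) \<in> D" by (auto simp: T_def)
    then show ?thesis using posD[OF that(1)] that(4) by blast
  qed
  txt \<open>Otherwise \<open>\<epsilon>\<^sub>i\<close> or \<open>\<epsilon>\<^sub>i + \<epsilon>\<^sub>k\<close> would have two representations in the cone over \<open>S\<close>.\<close>
  have zero: "(i, k) \<in> Z" if ik: "i \<in> T" "k \<in> T" "i < k" "(i, k) \<notin> D" for i k
  proof -
    have "(i, k) \<notin> A"
    proof
      assume "(i, k) \<in> A"
      then have \<alpha>: "Plus_Root i k \<in> S" by (simp add: A_def)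
      have "x (Plus_Root i k) $ i > 0" "x (Plus_Root i k) $ k > 0"
        using ik by (auto intro!: posT[OF \<alpha>])
      with neg[OF \<alpha>] show False by simp
    qed
    moreover have "(i, k) \<notin> B"
    proof
      assume B: "(i, k) \<in> B"
      \<comment> \<open>Writing \<open>axis i 1\<close> as
        \<open>(axis i 1 - axis k 1) + axis k 1\<close> gives a second representation. By
        \<open>(i, k) \<notin> D\<close> it avoids the generators of the first, so the vector of
        each of those generators is positive at \<open>i\<close>.\<close>
      obtain \<alpha> where \<alpha>: "\<alpha> \<in> S" "\<not> x \<alpha> $ i > 0" using coverH[of i] by force
      then have supp: "\<alpha> = Short_Root i \<or> (\<exists>j. (i, j) \<in> D \<and> \<alpha> \<in> {Plus_Root i j, Minus_Root i j})"
        using posT[OF \<alpha>(1) ik(1)] by blast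
      then have "x \<alpha> $ k > 0"
        using ik(3) by (intro posT[OF \<alpha>(1) ik(2)]) auto
      moreover have "x \<alpha> $ i - x \<alpha> $ k > 0"
        using supp ik(4) by (intro posB[OF \<alpha>(1) B]) auto
      ultimately show False using \<alpha>(2) by simp
    qed
    ultimately show ?thesis using ik(3) by (simp add: Z_def Q_def)
  qed
  \<comment> \<open>Otherwise \<open>axis i 1 + axis k 1\<close> is the sum of
    \<open>axis i 1 - axis k 1\<close> and twice \<open>axis k 1\<close>, on both of which its own
    vector is positive.\<close>
  have chain_notH: "k \<notin> H" if "(i, k) \<in> D" for i k
  proof
    assume k: "k \<in> H"
    have \<alpha>: "Plus_Root i k \<in> S" and "(i, k) \<in> B" using that by (auto simp: D_def A_def)
    from posB[OF this] posH[OF \<alpha> k] neg[OF \<alpha>] show False by simp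
  qed
  \<comment> \<open>Both roots of \<open>(i, l)\<close> are \<open>axis i 1 - axis k 1\<close> plus
    a root of \<open>(k, l)\<close>, hence sums of other members of \<open>S\<close>.\<close>
  have chain_zero: "(i, l) \<in> Z" if D: "(i, k) \<in> D" "(k, l) \<in> D" for i k l
  proof -
    have less: "i < k" "k < l" "i \<noteq> k" "l \<noteq> k" using D AB by (auto simp: D_def Q_def)
    have "(i, l) \<notin> A"
    proof
      assume "(i, l) \<in> A"
      then have \<alpha>: "Plus_Root i l \<in> S" by (simp add: A_def)
      show False
        using posB[OF \<alpha>, of i k] posA[OF \<alpha>, of k l] neg[OF \<alpha>] D less by (auto simp: D_def)
    qed
    moreover have "(i, l) \<notin> B"
    proof
      assume "(i, l) \<in> B"
      then have \<alpha>: "Minus_Root i l \<in> S" by (simp add: B_def)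
      show False
        using posB[OF \<alpha>, of i k] posB[OF \<alpha>, of k l] neg[OF \<alpha>] D less by (auto simp: D_def)
    qed
    ultimately show ?thesis using less by (auto simp: Z_def Q_def)
  qed
  have cardT: "card T \<le> card Z + 1"
  proof (cases "T = {}")
    case False
    define k where "k = Max T"
    have k: "k \<in> T" and k_max: "\<And>i. i \<in> T \<Longrightarrow> i \<le> k"
      using False by (auto simp: k_def)
    have "i \<in> fst ` Z" if i: "i \<in> T - {k}" for i
    proof (cases "(i, k) \<in> D")
      case True
      \<comment> \<open>As \<open>k\<close> is not in \<open>H\<close>, it lies in \<open>T\<close>
        through some \<open>(k, l) \<in> D\<close>; the empty pair starting at \<open>i\<close> is
        then \<open>(i, l)\<close> instead of \<open>(i, k)\<close>.\<close>
      then obtain l where "(k, l) \<in> D"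
        using k chain_notH[OF True] by (auto simp: T_def)
      from chain_zero[OF True this] show ?thesis by (simp add: rev_image_eqI)
    next
      case False
      have "i < k" using i k_max[of i] by auto
      with zero[of i k] i k False show ?thesis by (simp add: rev_image_eqI)
    qed
    then have "card (T - {k}) \<le> card (fst ` Z)" by (intro card_mono) auto
    also have "\<dots> \<le> card Z" by (rule card_image_le) simp
    finally show ?thesis using k by (simp add: card_Diff_singleton)
  qed simp
  have "S = (case_prod Plus_Root ` A \<union> case_prod Minus_Root ` B) \<union> Short_Root ` H" (is "_ = ?R")
  proof
    show "S \<subseteq> ?R"
    proof
      fix \<alpha> assume "\<alpha> \<in> S"
      then show "\<alpha> \<in> ?R" by (cases \<alpha>) (auto simp: A_def B_def H_def image_iff)
    qed
  qed (auto simp: A_def B_def H_def)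
  then have "card S \<le> card (case_prod Plus_Root ` A \<union> case_prod Minus_Root ` B) + card (Short_Root ` H)"
    by (simp add: card_Un_le)
  also have "\<dots> \<le> card (case_prod Plus_Root ` A) + card (case_prod Minus_Root ` B) + card (Short_Root ` H)"
    by (simp add: card_Un_le)
  also have "\<dots> \<le> card A + card B + card H"
    by (intro add_mono card_image_le) simp_all
  also have "card A + card B = card (A \<union> B) + card D"
    unfolding D_def by (rule card_Un_Int) simp_all
  \<comment> \<open>\<open>Dfun\<close> makes the first projection injective on \<open>D\<close>,
    and \<open>HD\<close> separates its image from \<open>H\<close>; together they make up
    \<open>T\<close>.\<close>
  also have "card D = card (fst ` D)"
    using Dfun by (intro card_image[symmetric]) (auto simp: inj_on_def)
  also have "card (A \<union> B) + card (fst ` D) + card H = card (A \<union> B) + card T"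
    unfolding T_def using HD by (subst card_Un_disjoint) auto
  also have "\<dots> \<le> card (A \<union> B) + card Z + 1" using cardT by simp
  also have "card (A \<union> B) + card Z = card Q"
    unfolding Z_def using AB by (simp add: card_Diff_subset card_mono)
  finally show ?thesis by (simp add: Q_def card_less_pairs)
qed

section \<open>The root system of type B\<close>

text \<open>Without the order on indices, the root set is visibly stable under signed permutations
  of the coordinates.\<close>

lemma B_roots_eq_signed:
  "(B_roots :: (real ^ 'n::{finite, linorder}) set) =
     {s *\<^sub>R axis i 1 + t *\<^sub>R axis j 1 | i j s t. i \<noteq> j \<and> s \<in> {1, -1} \<and> t \<in> {1, -1}} \<union>
     {s *\<^sub>R axis i 1 | i s. s \<in> {1, -1}}" (is "_ = ?L \<union> ?S")
proof
  show "B_roots \<subseteq> ?L \<union> ?S"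
  proof
    fix v :: "(real, 'n) vec" assume "v \<in> B_roots"
    then consider (a) i j where "i < j" "v = axis i 1 + axis j 1"
      | (b) i j where "i < j" "v = - (axis i 1 + axis j 1)"
      | (c) i j where "i < j" "v = axis i 1 - axis j 1"
      | (d) i j where "i < j" "v = - (axis i 1 - axis j 1)"
      | (e) i where "v = axis i 1" | (f) i where "v = - axis i 1"
      unfolding B_roots_def by blast
    then show "v \<in> ?L \<union> ?S"
    proof cases
      case a
      then have "v = 1 *\<^sub>R axis i 1 + 1 *\<^sub>R axis j 1" "i \<noteq> j" by auto
      then show ?thesis by blast
    next
      case b
      then have "v = (-1) *\<^sub>R axis i 1 + (-1) *\<^sub>R axis j 1" "i \<noteq> j" by auto
      then show ?thesis by blast
    next
      case c
      then have "v = 1 *\<^sub>R axis i 1 + (-1) *\<^sub>R axis j 1" "i \<noteq> j" by auto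
      then show ?thesis by blast
    next
      case d
      then have "v = (-1) *\<^sub>R axis i 1 + 1 *\<^sub>R axis j 1" "i \<noteq> j" by auto
      then show ?thesis by blast
    next
      case e
      then have "v = 1 *\<^sub>R axis i 1" by simp
      then show ?thesis by blast
    next
      case f
      then have "v = (-1) *\<^sub>R axis i 1" by simp
      then show ?thesis by blast
    qed
  qed
  have less: "s *\<^sub>R axis i 1 + t *\<^sub>R axis j 1 \<in> (B_roots :: (real, 'n) vec set)"
    if st: "s \<in> {1, -1}" "t \<in> {1, -1}" and "i < j" for i j :: 'n and s t :: real
  proof -
    consider "s = 1" "t = 1" | "s = -1" "t = -1" | "s = 1" "t = -1" | "s = -1" "t = 1"
      using st by blast
    then show ?thesis
    proof cases
      case 1
      then have "s *\<^sub>R axis i 1 + t *\<^sub>R axis j 1 = (axis i 1 + axis j 1 :: (real, 'n) vec)" by simp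
      with \<open>i < j\<close> show ?thesis unfolding B_roots_def by blast
    next
      case 2
      then have "s *\<^sub>R axis i 1 + t *\<^sub>R axis j 1 = (- (axis i 1 + axis j 1) :: (real, 'n) vec)" by simp
      with \<open>i < j\<close> show ?thesis unfolding B_roots_def by blast
    next
      case 3
      then have "s *\<^sub>R axis i 1 + t *\<^sub>R axis j 1 = (axis i 1 - axis j 1 :: (real, 'n) vec)" by simp
      with \<open>i < j\<close> show ?thesis unfolding B_roots_def by blast
    next
      case 4
      then have "s *\<^sub>R axis i 1 + t *\<^sub>R axis j 1 = (- (axis i 1 - axis j 1) :: (real, 'n) vec)" by simp
      with \<open>i < j\<close> show ?thesis unfolding B_roots_def by blast
    qed
  qed
  have long: "s *\<^sub>R axis i 1 + t *\<^sub>R axis j 1 \<in> (B_roots :: (real, 'n) vec set)"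
    if "i \<noteq> j" "s \<in> {1, -1}" "t \<in> {1, -1}" for i j :: 'n and s t :: real
    using less[of s t i j] less[of t s j i] that by (cases "i < j") (auto simp: add.commute)
  have short: "s *\<^sub>R axis i 1 \<in> (B_roots :: (real, 'n) vec set)"
    if "s \<in> {1, -1}" for i :: 'n and s :: real
  proof -
    have "axis i 1 \<in> (B_roots :: (real, 'n) vec set)" "- axis i 1 \<in> (B_roots :: (real, 'n) vec set)"
      unfolding B_roots_def by blast+
    with that show ?thesis by auto
  qed
  show "?L \<union> ?S \<subseteq> B_roots"
  proof (rule Un_least)
    show "?L \<subseteq> B_roots"
      by (rule subsetI, elim CollectE exE conjE, hypsubst, rule long)
    show "?S \<subseteq> B_roots"
      by (rule subsetI, elim CollectE exE conjE, hypsubst, rule short)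
  qed
qed

lemma B_roots_cases:
  assumes "v \<in> (B_roots :: (real ^ 'n::{finite, linorder}) set)"
  obtains (long) i j s t where "i \<noteq> j" "s \<in> {1, -1}" "t \<in> {1, -1}" "v = s *\<^sub>R axis i 1 + t *\<^sub>R axis j 1"
    | (short) i s where "s \<in> {1, -1}" "v = s *\<^sub>R axis i 1"
proof -
  from assms have "(\<exists>i j s t. v = s *\<^sub>R axis i 1 + t *\<^sub>R axis j 1 \<and> i \<noteq> j \<and> s \<in> {1, -1} \<and> t \<in> {1, -1}) \<or>
      (\<exists>i s. v = s *\<^sub>R axis i 1 \<and> s \<in> {1, -1})"
    by (simp only: B_roots_eq_signed Un_iff mem_Collect_eq)
  then show thesis
    by (elim disjE exE conjE) (rule long short, assumption+)+
qed

section \<open>Reflections as signed permutations of the standard basis\<close>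

lemma reflection_long_axis:
  fixes i j k :: "'n::finite" and s t :: real
  assumes "i \<noteq> j" "s \<in> {1, -1}" "t \<in> {1, -1}"
  shows "reflection (s *\<^sub>R axis i 1 + t *\<^sub>R axis j 1) (axis k 1) =
    (if k = i \<or> k = j then - s * t else 1) *\<^sub>R axis (Transposition.transpose i j k) (1::real)"
  using assms
  by (auto simp: reflection_def inner_simps inner_axis_axis Transposition.transpose_def algebra_simps)

lemma reflection_short_axis:
  fixes i k :: "'n::finite" and s :: real
  assumes "s \<in> {1, -1}"
  shows "reflection (s *\<^sub>R axis i 1) (axis k 1) = (if k = i then - 1 else 1) *\<^sub>R axis k (1::real)"
  using assms by (auto simp: reflection_def inner_simps inner_axis_axis vec_eq_iff)

lemma reflection_B_root_axis:
  assumes "\<alpha> \<in> (B_roots :: (real ^ 'n::{finite, linorder}) set)"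
  obtains \<sigma> \<tau> where "inj \<sigma>" "\<And>k. \<tau> k \<in> {1, -1}"
    "\<And>k. reflection \<alpha> (axis k 1) = \<tau> k *\<^sub>R axis (\<sigma> k) 1"
  using assms
proof (cases rule: B_roots_cases)
  case (long i j s t)
  show thesis
  proof (rule that)
    show "inj (Transposition.transpose i j)" by simp
    show "(if k = i \<or> k = j then - s * t else 1) \<in> {1, -1}" for k
      using long by auto
  qed (use long reflection_long_axis in blast)
next
  case (short i s)
  show thesis
  proof (rule that)
    show "inj (\<lambda>k::'n. k)" by simp
    show "(if k = i then - 1 else 1 :: real) \<in> {1, -1}" for k
      by auto
  qed (use short reflection_short_axis in blast)
qed

lemma reflection_B_roots:
  assumes "\<alpha> \<in> B_roots" "\<beta> \<in> (B_roots :: (real ^ 'n::{finite, linorder}) set)"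
  shows "reflection \<alpha> \<beta> \<in> B_roots"
proof -
  obtain \<sigma> \<tau> where \<sigma>: "inj \<sigma>" and \<tau>: "\<And>k. \<tau> k \<in> {1, -1}"
    and R: "\<And>k. reflection \<alpha> (axis k 1) = \<tau> k *\<^sub>R axis (\<sigma> k) 1"
    using reflection_B_root_axis[OF assms(1)] by blast
  have lin: "linear (reflection \<alpha>)"
    by (intro orthogonal_transformation_linear orthogonal_transformation_reflection)
  have sign: "s * \<tau> k \<in> {1, -1}" if "s \<in> {1, -1}" for s k
    using that \<tau>[of k] by auto
  show ?thesis
    using assms(2)
  proof (cases rule: B_roots_cases)
    case (long i j s t)
    then have "reflection \<alpha> \<beta> = (s * \<tau> i) *\<^sub>R axis (\<sigma> i) 1 + (t * \<tau> j) *\<^sub>R axis (\<sigma> j) 1"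
      by (simp add: linear_add[OF lin] linear_cmul[OF lin] R)
    moreover have "\<sigma> i \<noteq> \<sigma> j" using \<sigma> long(1) by (simp add: inj_eq)
    ultimately show ?thesis
      unfolding B_roots_eq_signed using sign[OF long(2), of i] sign[OF long(3), of j] by blast
  next
    case (short i s)
    then have "reflection \<alpha> \<beta> = (s * \<tau> i) *\<^sub>R axis (\<sigma> i) 1"
      by (simp add: linear_cmul[OF lin] R)
    then show ?thesis
      unfolding B_roots_eq_signed using sign[OF short(1), of i] by blast
  qed
qed

text \<open>This is \<open>(n, n - 1, ..., 1)\<close>; positive, strictly decreasing coordinates
  make every positive root positive on it.\<close>

definition dominant_vec :: "real ^ 'n::{finite, linorder}" where
  "dominant_vec = (\<chi> i. real (card {i..}))"

section \<open>Type B as a positive system, and the upper bound\<close>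

lemma finite_pos_indices: "finite (pos_indices :: 'n::{finite, linorder} root_index set)"
proof (rule finite_subset)
  show "(pos_indices :: 'n root_index set) \<subseteq>
      range (case_prod Plus_Root) \<union> range (case_prod Minus_Root) \<union> range Short_Root"
  proof
    fix r :: "'n root_index"
    show "r \<in> range (case_prod Plus_Root) \<union> range (case_prod Minus_Root) \<union> range Short_Root"
      by (cases r) (auto simp: image_iff)
  qed
qed simp

lemma B_roots_pos: "B_roots = B_pos_roots \<union> uminus ` (B_pos_roots :: (real ^ 'n::{finite, linorder}) set)"
proof -
  have image_Collect2: "uminus ` {f i j | i j. i < j} = {- f i j | i j. i < j}" for f :: "'n \<Rightarrow> 'n \<Rightarrow> (real, 'n) vec"
    by blast
  have image_Collect1: "uminus ` {f i | i. True} = {- f i | i. True}" for f :: "'n \<Rightarrow> (real, 'n) vec"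
    by blast
  show ?thesis
    unfolding B_roots_def B_pos_roots_def image_Un image_Collect2 image_Collect1
    by (simp only: Un_ac)
qed

interpretation B: positive_system
  "B_roots :: (real ^ 'n::{finite, linorder}) set" B_pos_roots dominant_vec
proof
  show "finite (B_roots :: (real, 'n) vec set)"
    by (simp add: B_roots_pos B_pos_roots_eq finite_pos_indices)
  have "Basis \<subseteq> (B_roots :: (real, 'n) vec set)"
    unfolding Basis_vec_def B_roots_def by auto
  then show "span (B_roots :: (real, 'n) vec set) = UNIV"
    by (metis span_Basis span_mono top.extremum_uniqueI)
  show "dominant_vec \<bullet> \<beta> > 0" if "\<beta> \<in> B_pos_roots" for \<beta> :: "(real, 'n) vec"
  proof -
    have pos: "card {i..} > 0" for i :: 'n
      by (auto simp: card_gt_0_iff)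
    have less: "card {j..} < card {i..}" if "i < j" for i j :: 'n
      using that by (intro psubset_card_mono) auto
    from that obtain r where "r \<in> pos_indices" "\<beta> = root_vec r"
      by (auto simp: B_pos_roots_eq)
    then show ?thesis
      using pos less by (cases r) (auto simp: dominant_vec_def add_pos_pos)
  qed
qed (fact B_roots_pos reflection_B_roots)+

lemma card_minimal_inversion_complete_le:
  assumes Y: "minimal_inversion_complete (B_roots :: (real ^ 'n::{finite, linorder}) set) B_pos_roots Y"
  shows "card Y \<le> (CARD('n) choose 2) + 1"
proof -
  have W: "w \<in> weyl_group B_roots" if "w \<in> Y" for w
    using that Y unfolding minimal_inversion_complete_def inversion_complete_def by blast
  have "\<exists>r\<in>pos_indices. \<forall>v\<in>Y. root_vec r \<in> inversion_set B_pos_roots v \<longleftrightarrow> v = w" if "w \<in> Y" for w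
    using B.minimal_inversion_complete_private_root[OF Y that] by (auto simp: B_pos_roots_eq)
  then obtain r where r: "\<And>w. w \<in> Y \<Longrightarrow> r w \<in> pos_indices"
    and excl: "\<And>w v. w \<in> Y \<Longrightarrow> v \<in> Y \<Longrightarrow> root_vec (r w) \<in> inversion_set B_pos_roots v \<longleftrightarrow> v = w"
    by metis
  have inj: "inj_on r Y"
    using excl by (metis inj_onI)
  \<comment> \<open>Each private index is traced back to its owner \<open>w\<close>, so that the
    signs of \<open>w dominant_vec\<close> express inversion by \<open>w\<close>.\<close>
  define x where "x \<alpha> = inv_into Y r \<alpha> dominant_vec" for \<alpha>
  have x: "x (r w) = w dominant_vec" if "w \<in> Y" for w
    using that inj by (simp add: x_def)
  have "card (r ` Y) \<le> (CARD('n) choose 2) + 1"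
  proof (rule card_separated_cover_le[of _ x])
    show "r ` Y \<subseteq> pos_indices" using r by blast
    show "x \<alpha> \<bullet> root_vec \<alpha> < 0" if "\<alpha> \<in> r ` Y" for \<alpha>
      using that r excl x B.inversion_set_iff(1)[OF W] by (auto simp: B_pos_roots_eq)
    show "x \<alpha> \<bullet> root_vec \<beta> > 0" if "\<alpha> \<in> r ` Y" "\<beta> \<in> r ` Y" "\<alpha> \<noteq> \<beta>" for \<alpha> \<beta>
    proof -
      from that obtain v w where "v \<in> Y" "w \<in> Y" "\<alpha> = r v" "\<beta> = r w" "v \<noteq> w"
        by blast
      then show ?thesis
        using r[of w] excl[of w v] x[of v] B.inversion_set_iff(2)[OF W[of v], of "root_vec \<beta>"]
        by (auto simp: B_pos_roots_eq)
    qed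
    show "\<exists>\<alpha>\<in>r ` Y. x \<alpha> \<bullet> root_vec \<beta> < 0" if "\<beta> \<in> pos_indices" for \<beta>
    proof -
      have "root_vec \<beta> \<in> B_pos_roots" using that by (simp add: B_pos_roots_eq)
      moreover have "(\<Union>w\<in>Y. inversion_set B_pos_roots w) = (B_pos_roots :: (real, 'n) vec set)"
        using Y unfolding minimal_inversion_complete_def inversion_complete_def by blast
      ultimately obtain w where "w \<in> Y" "root_vec \<beta> \<in> inversion_set B_pos_roots w"
        by blast
      then show ?thesis
        using \<open>root_vec \<beta> \<in> B_pos_roots\<close> B.inversion_set_iff(1)[OF W[of w], of "root_vec \<beta>"] x[of w]
        by (auto intro!: bexI[of _ w])
    qed
  qed
  with inj show ?thesis by (simp add: card_image)
qed

section \<open>A large minimal inversion complete set\<close>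

text \<open>The pair \<open>(m, m)\<close>, with \<open>m\<close> the largest index, encodes the short root \<open>\<epsilon>\<^sub>m\<close>. The positive
  value at \<open>m\<close> in the vectors for \<open>\<epsilon>\<^sub>i + \<epsilon>\<^sub>m\<close> keeps them from inverting \<open>\<epsilon>\<^sub>m\<close>.\<close>

definition witness_vec :: "'n \<times> 'n \<Rightarrow> real ^ 'n::{finite, linorder}" where
  "witness_vec = (\<lambda>(i, j). \<chi> k.
     if k = j then (if j = Max UNIV \<and> i \<noteq> j then 1 else -1)
     else if k = i then -2 else 3 + real (card {..<k}))"

definition witness_root :: "'n \<times> 'n \<Rightarrow> 'n root_index" where
  "witness_root = (\<lambda>(i, j). if i = j then Short_Root j else Plus_Root i j)"

definition witness_pairs :: "('n::{finite, linorder} \<times> 'n) set" where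
  "witness_pairs = insert (Max UNIV, Max UNIV) {(i, j). i < j}"

lemma card_witness_pairs: "card (witness_pairs :: ('n::{finite, linorder} \<times> 'n) set) = (CARD('n) choose 2) + 1"
  unfolding witness_pairs_def by (subst card_insert_disjoint) (auto simp: card_less_pairs)

lemma card_lessThan_less:
  fixes a b :: "'n::{finite, linorder}"
  assumes "a < b"
  shows "card {..<a} < card {..<b}"
  using assms by (intro psubset_card_mono) auto

text \<open>The coordinates are nonzero, distinct, and never opposite; the term
  \<open>card {..<k}\<close> keeps the large ones apart. This is what
  \<open>exists_inversion_set\<close> requires.\<close>

lemma witness_vec_generic:
  assumes "p \<in> witness_pairs" "r \<in> pos_indices"
  shows "witness_vec p \<bullet> root_vec r \<noteq> 0"
proof -
  obtain i j where p: "p = (i, j)" by (cases p)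
  have d: "real (card {..<a}) < real (card {..<b})" if "a < b" for a b :: 'a
    using card_lessThan_less[OF that] by simp
  show ?thesis
    using assms(2)
  proof (cases r)
    case (Plus_Root a b)
    with assms(2) show ?thesis by (auto simp: p witness_vec_def)
  next
    case (Minus_Root a b)
    with assms(2) d[of a b] show ?thesis by (auto simp: p witness_vec_def)
  next
    case (Short_Root a)
    then show ?thesis by (auto simp: p witness_vec_def)
  qed
qed

lemma witness_root_mem: "p \<in> witness_pairs \<Longrightarrow> witness_root p \<in> pos_indices"
  by (auto simp: witness_pairs_def witness_root_def)

lemma le_Max_UNIV: "(k::'n::{finite, linorder}) \<le> Max UNIV"
  by (rule Max_ge) simp_all

text \<open>Coordinates off the pair are at least 3 and outweigh -2, so among sums of two distinct
  coordinates only the one at the pair itself can be negative.\<close>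

lemma witness_sign:
  assumes "p \<in> witness_pairs" "q \<in> witness_pairs"
  shows "witness_vec p \<bullet> root_vec (witness_root q) < 0 \<longleftrightarrow> p = q"
proof -
  obtain i j k l where pq: "p = (i, j)" "q = (k, l)" by (cases p, cases q)
  let ?m = "Max UNIV :: 'a"
  have p: "i < j \<or> i = ?m \<and> j = ?m" and q: "k < l \<or> k = ?m \<and> l = ?m"
    using assms by (auto simp: pq witness_pairs_def)
  have m: "\<not> ?m < a" for a using le_Max_UNIV by (rule leD)
  show ?thesis
    using p q m by (auto simp: pq witness_vec_def witness_root_def)
qed

text \<open>Each \<open>Plus_Root\<close> has its own vector. The vector of
  \<open>(a, Max UNIV)\<close> has its smallest coordinate, a negative one, at \<open>a\<close>,
  which covers the other roots with first index \<open>a\<close>.\<close>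

lemma witness_cover:
  assumes "r \<in> (pos_indices :: 'n::{finite, linorder} root_index set)"
  shows "\<exists>p\<in>witness_pairs. witness_vec p \<bullet> root_vec r < 0"
proof -
  let ?m = "Max UNIV :: 'n"
  have m: "a < ?m \<or> a = ?m" for a using le_Max_UNIV[of a] by (simp add: less_le)
  show ?thesis
  proof (cases r)
    case (Plus_Root a b)
    with assms have "(a, b) \<in> witness_pairs" "witness_root (a, b) = r"
      by (auto simp: witness_pairs_def witness_root_def)
    then show ?thesis using witness_sign by metis
  next
    case (Minus_Root a b)
    with assms have "a < b" by simp
    then have "a < ?m" using m[of b] by auto
    then have "(a, ?m) \<in> witness_pairs" by (auto simp: witness_pairs_def)
    moreover have "witness_vec (a, ?m) \<bullet> root_vec r < 0"
      using \<open>a < ?m\<close> \<open>a < b\<close> by (auto simp: Minus_Root witness_vec_def)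
    ultimately show ?thesis by blast
  next
    case (Short_Root a)
    have "(a, ?m) \<in> witness_pairs" using m[of a] by (auto simp: witness_pairs_def)
    moreover have "witness_vec (a, ?m) \<bullet> root_vec r < 0"
      by (auto simp: Short_Root witness_vec_def)
    ultimately show ?thesis by blast
  qed
qed

lemma exists_minimal_inversion_complete:
  "\<exists>Y. minimal_inversion_complete (B_roots :: (real ^ 'n::{finite, linorder}) set) B_pos_roots Y \<and>
     card Y = (CARD('n) choose 2) + 1"
proof -
  let ?K = "witness_pairs :: ('n \<times> 'n) set" and ?P = "B_pos_roots :: (real, 'n) vec set"
  have "\<forall>p\<in>?K. \<exists>w. w \<in> weyl_group B_roots \<and> inversion_set ?P w = {\<beta> \<in> ?P. witness_vec p \<bullet> \<beta> < 0}"
  proof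
    fix p assume p: "p \<in> ?K"
    have "witness_vec p \<bullet> \<beta> \<noteq> 0" if "\<beta> \<in> ?P" for \<beta>
      using that witness_vec_generic[OF p] by (auto simp: B_pos_roots_eq)
    from B.exists_inversion_set[OF this] show "\<exists>w. w \<in> weyl_group B_roots \<and> inversion_set ?P w = {\<beta> \<in> ?P. witness_vec p \<bullet> \<beta> < 0}"
      by blast
  qed
  from bchoice[OF this] obtain w where w: "\<And>p. p \<in> ?K \<Longrightarrow> w p \<in> weyl_group B_roots"
    and N: "\<And>p. p \<in> ?K \<Longrightarrow> inversion_set ?P (w p) = {\<beta> \<in> ?P. witness_vec p \<bullet> \<beta> < 0}"
    by blast
  have mem: "root_vec (witness_root q) \<in> ?P" if "q \<in> ?K" for q
    using witness_root_mem[OF that] by (simp add: B_pos_roots_eq)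
  have excl: "root_vec (witness_root q) \<in> inversion_set ?P (w p) \<longleftrightarrow> p = q"
    if "p \<in> ?K" "q \<in> ?K" for p q
    using that witness_sign[of p q] mem[of q] by (simp add: N)
  have "inj_on w ?K"
    using excl by (metis inj_onI)
  then have "card (w ` ?K) = (CARD('n) choose 2) + 1"
    by (simp add: card_image card_witness_pairs)
  moreover have "minimal_inversion_complete B_roots ?P (w ` ?K)"
    unfolding minimal_inversion_complete_def
  proof (intro conjI allI impI)
    have "\<beta> \<in> (\<Union>v\<in>w ` ?K. inversion_set ?P v)" if "\<beta> \<in> ?P" for \<beta>
    proof -
      obtain r where "r \<in> pos_indices" "\<beta> = root_vec r"
        using \<open>\<beta> \<in> ?P\<close> by (auto simp: B_pos_roots_eq)
      with witness_cover[of r] obtain p where "p \<in> ?K" "witness_vec p \<bullet> \<beta> < 0" by blast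
      with that have "\<beta> \<in> inversion_set ?P (w p)" by (simp add: N)
      with \<open>p \<in> ?K\<close> show ?thesis by blast
    qed
    moreover have "inversion_set ?P v \<subseteq> ?P" for v
      by (auto simp: inversion_set_def)
    ultimately show "inversion_complete B_roots ?P (w ` ?K)"
      unfolding inversion_complete_def using w by blast
    fix Z assume "Z \<subset> w ` ?K"
    \<comment> \<open>A proper subset omits some \<open>w q\<close>, and the root private to
      \<open>w q\<close> is then uncovered.\<close>
    then obtain q where q: "q \<in> ?K" "w q \<notin> Z" "Z \<subseteq> w ` ?K" by blast
    then have "root_vec (witness_root q) \<notin> (\<Union>v\<in>Z. inversion_set ?P v)"
      using excl by blast
    with mem[OF q(1)] show "\<not> inversion_complete B_roots ?P Z"
      unfolding inversion_complete_def by blast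
  qed
  ultimately show ?thesis by blast
qed

theorem theorem1p2:
  assumes "CARD('n::{finite, linorder}) \<ge> 2"
  shows "MC (B_roots :: (real ^ 'n::{finite, linorder}) set) B_pos_roots = (CARD('n) choose 2) + 1"
  unfolding MC_def
proof (rule Max_eqI)
  show "finite (card ` {Y. minimal_inversion_complete (B_roots :: (real, 'n) vec set) B_pos_roots Y})"
    by (simp add: B.finite_minimal_inversion_complete)
  show "k \<le> (CARD('n) choose 2) + 1"
    if "k \<in> card ` {Y. minimal_inversion_complete (B_roots :: (real, 'n) vec set) B_pos_roots Y}" for k
    using that card_minimal_inversion_complete_le by blast
  show "(CARD('n) choose 2) + 1 \<in> card ` {Y. minimal_inversion_complete (B_roots :: (real, 'n) vec set) B_pos_roots Y}"
    using exists_minimal_inversion_complete[where 'n = 'n] by force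
qed

end
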